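(* Let $\tau,\tau'$ be tasks, and let $\square_\tau,\blacksquare_{\tau'}\in\mathbb R$ be the values of a priority criterion, where $\blacksquare_{\tau'}\ge\square_\tau$ means that $\tau'$ has higher or equal priority, so that every job of $\tau'$ interferes with $\tau$, and otherwise no job of $\tau'$ interferes with $\tau$. Then for every $t\in\mathbb R$ and every interval $\Delta_{a,b}=[t_a,t_b)$, the interference request bound $\rho^{\blacksquare\ge\square}(t,\Delta_{a,b})$, i.e. the total execution time of the jobs of $\tau'$ that interfere with $\tau$ and are requested in $[t_a,t_b)$ and no later than $t$, is obtained by masking the request bound of $\tau'$: $$\rho^{\blacksquare\ge\square}(t,\Delta_{a,b})=\left(\int_{-\infty}^{t}\sum_{e\in E_{\tau'}}\sum_{n=0}^{k-1}\delta(t'-a_e-np_e)\,C^{n}_{\tau',e}\,H^u(t'-t_a)\,H^l(t_b-t')\,dt'\right)\cdot H^u(\blacksquare_{\tau'}-\square_{\tau}).$$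
   Context: A task $\tau'$ has a finite event list $E_{\tau'}$ of event tuples $e$ with period $p_e\ge0$ and minimal distance $a_e\ge0$, and a bound $k\in\mathbb N\cup\{\infty\}$ (all $p_e>0$ if $k=\infty$). Its jobs are the pairs $(e,n)$ with $e\in E_{\tau'}$, $0\le n\le k-1$ (all $n\ge0$ if $k=\infty$); job $(e,n)$ is requested at time $a_e+np_e$ and has execution time $C^n_{\tau',e}\ge0$. $\delta(t'-s)\,dt'$ is the unit point mass at $s$, and $\int_{-\infty}^t$ is over $(-\infty,t]$, including a point mass at $t$. Upper Heaviside function: $H^u(x)=1$ for $x\ge0$, $0$ for $x<0$. Lower Heaviside function: $H^l(x)=1$ for $x>0$, $0$ for $x\le0$. *)

theory Defs
  imports "HOL-Probability.Probability" "HOL-Library.Extended_Nat"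
begin

record event =
  period :: real
  min_distance :: real

text \<open>
  Events are referred to by their position in the event list, so that a list containing
  the same tuple twice describes two events, each with its own jobs and execution times:
  \<^term>\<open>exec_time T i n\<close> is the execution time of the \<open>n\<close>-th job of the
  \<open>i\<close>-th event.
\<close>

record task =
  events :: "event list"
  job_bound :: enat
  exec_time :: "nat \<Rightarrow> nat \<Rightarrow> real"

definition job_indices :: "task \<Rightarrow> nat set" where
  "job_indices T = {n. enat n < job_bound T}"

definition jobs :: "task \<Rightarrow> (nat \<times> nat) set" where
  "jobs T = {..<length (events T)} \<times> job_indices T"

definition request_time :: "task \<Rightarrow> nat \<Rightarrow> nat \<Rightarrow> real" where
  "request_time T i n = min_distance (events T ! i) + real n * period (events T ! i)"

definition is_task :: "task \<Rightarrow> bool" where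
  "is_task T \<longleftrightarrow>
     (\<forall>e\<in>set (events T). 0 \<le> period e \<and> 0 \<le> min_distance e) \<and>
     (job_bound T = \<infinity> \<longrightarrow> (\<forall>e\<in>set (events T). 0 < period e)) \<and>
     (\<forall>(i, n)\<in>jobs T. 0 \<le> exec_time T i n)"

definition heaviside_upper :: "real \<Rightarrow> real" where
  "heaviside_upper x = (if x \<ge> 0 then 1 else 0)"

definition heaviside_lower :: "real \<Rightarrow> real" where
  "heaviside_lower x = (if x > 0 then 1 else 0)"

text \<open>
  The priority criteria are two functions, one read at the disturbed task (\<open>sq\<close>) and
  one at the interfering task (\<open>bsq\<close>); a larger value is a higher priority.
\<close>

definition interfering_jobs ::
    "(task \<Rightarrow> real) \<Rightarrow> (task \<Rightarrow> real) \<Rightarrow> task \<Rightarrow> task \<Rightarrow> (nat \<times> nat) set" where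
  "interfering_jobs bsq sq T' T = (if bsq T' \<ge> sq T then jobs T' else {})"

definition interference_request_bound ::
    "(task \<Rightarrow> real) \<Rightarrow> (task \<Rightarrow> real) \<Rightarrow> task \<Rightarrow> task \<Rightarrow> real \<Rightarrow> real set \<Rightarrow> real" where
  "interference_request_bound bsq sq T' T t \<Delta> =
     (\<Sum>(i, n) \<in> {(i, n) \<in> interfering_jobs bsq sq T' T.
                    request_time T' i n \<in> \<Delta> \<and> request_time T' i n \<le> t}.
        exec_time T' i n)"

text \<open>
  The measure \<open>\<Sum>\<^sub>e \<Sum>\<^sub>n C \<delta>(t' - a - n p) dt'\<close>; the unit point mass at
  \<open>s\<close> is \<^term>\<open>return borel s\<close>.
\<close>

definition request_measure :: "task \<Rightarrow> real measure" where
  "request_measure T = measure_of UNIV (sets borel)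
     (\<lambda>A. \<Sum>i<length (events T). \<Sum>\<^sub>\<infinity>n\<in>job_indices T.
        ennreal (exec_time T i n) * emeasure (return borel (request_time T i n)) A)"

lemma space_request_measure [simp]: "space (request_measure T) = UNIV"
  by (simp add: request_measure_def space_measure_of_conv)

lemma sets_request_measure [simp, measurable_cong]: "sets (request_measure T) = sets borel"
  using sets.sigma_sets_eq[of "borel :: real measure"]
  by (simp add: request_measure_def)

lemma infsum_ennreal_eq_suminf:
  fixes f :: "nat \<Rightarrow> ennreal"
  shows "infsum f A = (\<Sum>n. f n * indicator A n)"
proof -
  have "infsum f A = infsum (\<lambda>n. f n * indicator A n) UNIV"
    by (rule infsum_cong_neutral) (auto simp: indicator_def)
  also have "\<dots> = (\<Sum>n. f n * indicator A n)"
    by (intro sums_unique has_sum_imp_sums has_sum_infsum nonneg_summable_on_complete) auto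
  finally show ?thesis .
qed

text \<open>
  \<^const>\<open>measure_of\<close> collapses to the null measure unless the given set function is
  countably additive, which it is here.
\<close>

lemma emeasure_request_measure:
  assumes "A \<in> sets borel"
  shows "emeasure (request_measure T) A =
    (\<Sum>i<length (events T). \<Sum>\<^sub>\<infinity>n\<in>job_indices T.
        ennreal (exec_time T i n) * emeasure (return borel (request_time T i n)) A)"
proof (unfold request_measure_def, rule emeasure_measure_of_sigma)
  let ?c = "\<lambda>i n. ennreal (exec_time T i n)"
  let ?d = "\<lambda>i n. return borel (request_time T i n)"
  let ?\<mu> = "\<lambda>A. \<Sum>i<length (events T). \<Sum>\<^sub>\<infinity>n\<in>job_indices T. ?c i n * emeasure (?d i n) A"
  show "sigma_algebra UNIV (sets borel :: real set set)"
    using sets.sigma_algebra_axioms[of "borel :: real measure"] by simp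
  show "positive (sets borel) ?\<mu>"
    by (simp add: positive_def)
  show "countably_additive (sets borel) ?\<mu>"
  proof (rule countably_additiveI)
    fix B :: "nat \<Rightarrow> real set"
    assume B: "range B \<subseteq> sets borel" "disjoint_family B"
    have sub: "emeasure (?d i n) (\<Union>m. B m) = (\<Sum>m. emeasure (?d i n) (B m))" for i n
      using B by (intro suminf_emeasure[symmetric]) auto
    let ?f = "\<lambda>i n m. ?c i n * emeasure (?d i n) (B m) * indicator (job_indices T) n"
    have swap: "(\<Sum>m n. ?f i n m) = (\<Sum>n m. ?f i n m)" for i
      using nn_integral_suminf[of "\<lambda>m n. ?f i n m" "count_space UNIV"]
      unfolding nn_integral_count_space_nat by simp
    have pull: "(\<Sum>m. ?f i n m) = ?c i n * emeasure (?d i n) (\<Union>m. B m) * indicator (job_indices T) n"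
      for i n
      by (simp only: sub ennreal_suminf_multc ennreal_suminf_cmult)
    have "(\<Sum>m. ?\<mu> (B m)) = (\<Sum>m. \<Sum>i<length (events T). \<Sum>n. ?f i n m)"
      by (simp only: infsum_ennreal_eq_suminf)
    also have "\<dots> = (\<Sum>i<length (events T). \<Sum>m n. ?f i n m)"
      by (rule suminf_sum) (rule summableI)
    also have "\<dots> = ?\<mu> (\<Union>m. B m)"
      by (simp only: swap pull infsum_ennreal_eq_suminf)
    finally show "(\<Sum>m. ?\<mu> (B m)) = ?\<mu> (\<Union>m. B m)" .
  qed
qed (fact assms)

text \<open>
  The sum defining the interference request bound is finite: when the number of jobs is
  unbounded, all periods are positive.
\<close>

lemma finite_requests_upto:
  assumes "is_task T"
  shows "finite {(i, n) \<in> jobs T. request_time T i n \<le> t}"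
proof (cases "job_bound T")
  case (enat k)
  then have "finite (jobs T)" by (simp add: jobs_def job_indices_def)
  then show ?thesis by (rule finite_subset[rotated]) auto
next
  case infinity
  have "finite {n. request_time T i n \<le> t}" if "i < length (events T)" for i
  proof -
    have e: "0 < period (events T ! i)" "0 \<le> min_distance (events T ! i)"
      using assms infinity that by (auto simp: is_task_def)
    have "n \<le> nat \<lceil>t / period (events T ! i)\<rceil>" if "request_time T i n \<le> t" for n
    proof -
      have "real n * period (events T ! i) \<le> t"
        using that e by (simp add: request_time_def)
      then have "real n \<le> t / period (events T ! i)"
        using e by (simp add: field_simps)
      then show ?thesis by linarith
    qed
    then have "{n. request_time T i n \<le> t} \<subseteq> {..nat \<lceil>t / period (events T ! i)\<rceil>}"
      by blast
    then show ?thesis by (rule finite_subset) (rule finite_atMost)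
  qed
  then have "finite (SIGMA i:{..<length (events T)}. {n. request_time T i n \<le> t})"
    by (rule finite_SigmaI[OF finite_lessThan]) simp
  moreover have "{(i, n) \<in> jobs T. request_time T i n \<le> t} \<subseteq>
      (SIGMA i:{..<length (events T)}. {n. request_time T i n \<le> t})"
    by (auto simp: jobs_def)
  ultimately show ?thesis by (rule finite_subset[rotated])
qed

end

theory Submission
  imports Defs
begin

text \<open>On (-infinity, t] the product of the two Heaviside functions is the indicator of [t_a,
  t_b), so the integral is the mass that \<open>request_measure\<close> gives to A = (-infinity, t]
  \<inter> [t_a, t_b). This measure is a sum of point masses at the request times, weighted by
  execution times, so the mass of A is the total execution time of the jobs requested in A
  (\<open>measure_request_measure_eq_sum\<close>). The outer Heaviside factor keeps or annihilates
  this total, just as the priority test keeps or discards all jobs.\<close>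

text \<open>The upper bound t on A is what makes the sum finite: by
  \<open>finite_requests_upto\<close> only finitely many jobs are requested up to t.\<close>

lemma emeasure_request_measure_eq_sum:
  assumes T: "is_task T" and A: "A \<in> sets borel" "A \<subseteq> {..t}"
  shows "emeasure (request_measure T) A =
    (\<Sum>(i, n)\<in>{(i, n) \<in> jobs T. request_time T i n \<in> A}. ennreal (exec_time T i n))"
proof -
  let ?J = "\<lambda>i. {n \<in> job_indices T. request_time T i n \<in> A}"
  have jobs_A: "{(i, n) \<in> jobs T. request_time T i n \<in> A} = (SIGMA i:{..<length (events T)}. ?J i)"
    by (auto simp: jobs_def)
  have fin: "finite (SIGMA i:{..<length (events T)}. ?J i)"
    unfolding jobs_A[symmetric]
    by (rule finite_subset[OF _ finite_requests_upto[OF T, of t]]) (use A in auto)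
  \<comment> \<open>Each \<open>?J i\<close> lies in the projection of the finite set of pairs to
    the second component.\<close>
  have fin_J: "finite (?J i)" if "i < length (events T)" for i
    using finite_imageI[OF fin, of snd] by (rule finite_subset[rotated]) (use that in force)
  have "emeasure (request_measure T) A =
      (\<Sum>i<length (events T). \<Sum>\<^sub>\<infinity>n\<in>job_indices T.
        ennreal (exec_time T i n) * indicator A (request_time T i n))"
    using A by (simp add: emeasure_request_measure)
  also have "\<dots> = (\<Sum>i<length (events T). \<Sum>n\<in>?J i. ennreal (exec_time T i n))"
  proof (rule sum.cong[OF refl])
    fix i assume "i \<in> {..<length (events T)}"
    then have "finite (?J i)"
      by (intro fin_J) simp
    \<comment> \<open>A point mass located outside \<open>A\<close> contributes 0, so the infinite
      sum is supported on the finite set \<open>?J i\<close>.\<close>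
    moreover have "(\<Sum>\<^sub>\<infinity>n\<in>job_indices T. ennreal (exec_time T i n) * indicator A (request_time T i n)) =
        (\<Sum>\<^sub>\<infinity>n\<in>?J i. ennreal (exec_time T i n))"
      by (rule infsum_cong_neutral) auto
    ultimately show "(\<Sum>\<^sub>\<infinity>n\<in>job_indices T. ennreal (exec_time T i n) * indicator A (request_time T i n)) =
        (\<Sum>n\<in>?J i. ennreal (exec_time T i n))"
      by simp
  qed
  also have "\<dots> = (\<Sum>(i, n)\<in>(SIGMA i:{..<length (events T)}. ?J i). ennreal (exec_time T i n))"
    by (rule sum.Sigma) (auto intro: fin_J)
  finally show ?thesis
    unfolding jobs_A .
qed

text \<open>Passing to real values is safe for two reasons: execution times of jobs are nonnegative,
  so \<open>ennreal\<close> does not truncate them, and the sum is finite, so \<open>measure\<close>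
  does not fall back to its default 0 for infinite mass.\<close>

lemma measure_request_measure_eq_sum:
  assumes T: "is_task T" and A: "A \<in> sets borel" "A \<subseteq> {..t}"
  shows "measure (request_measure T) A =
    (\<Sum>(i, n)\<in>{(i, n) \<in> jobs T. request_time T i n \<in> A}. exec_time T i n)"
proof -
  have nonneg: "0 \<le> (case x of (i, n) \<Rightarrow> exec_time T i n)" if "x \<in> jobs T" for x
    using T that by (auto simp: is_task_def)
  have "emeasure (request_measure T) A =
      ennreal (\<Sum>(i, n)\<in>{(i, n) \<in> jobs T. request_time T i n \<in> A}. exec_time T i n)"
    unfolding emeasure_request_measure_eq_sum[OF assms]
    by (subst sum_ennreal[symmetric]) (auto intro!: sum.cong dest: nonneg)
  then show ?thesis
    by (rule measure_eq_emeasure_eq_ennreal[rotated]) (auto intro!: sum_nonneg dest: nonneg)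
qed

theorem theorem3:
  fixes \<tau> \<tau>' :: task
    and sq bsq :: "task \<Rightarrow> real"
    and t t\<^sub>a t\<^sub>b :: real
  assumes "is_task \<tau>" and "is_task \<tau>'"
  shows "interference_request_bound bsq sq \<tau>' \<tau> t {t\<^sub>a..<t\<^sub>b} =
    (LINT t':{..t}|request_measure \<tau>'.
        heaviside_upper (t' - t\<^sub>a) * heaviside_lower (t\<^sub>b - t')) *
      heaviside_upper (bsq \<tau>' - sq \<tau>)"
proof -
  let ?A = "{..t} \<inter> {t\<^sub>a..<t\<^sub>b}"
  have "(LINT t':{..t}|request_measure \<tau>'.
        heaviside_upper (t' - t\<^sub>a) * heaviside_lower (t\<^sub>b - t')) =
      (LINT t'|request_measure \<tau>'. indicator ?A t')"
    \<comment> \<open>The endpoints match the half-open interval: \<open>heaviside_upper\<close> is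
      1 at 0 and keeps \<open>t\<^sub>a\<close>, while \<open>heaviside_lower\<close> is 0 at 0 and
      drops \<open>t\<^sub>b\<close>.\<close>
    unfolding set_lebesgue_integral_def
    by (intro Bochner_Integration.integral_cong)
      (auto simp: heaviside_upper_def heaviside_lower_def indicator_def)
  also have "\<dots> = measure (request_measure \<tau>') ?A"
    by simp
  also have "\<dots> = (\<Sum>(i, n)\<in>{(i, n) \<in> jobs \<tau>'. request_time \<tau>' i n \<in> ?A}. exec_time \<tau>' i n)"
    by (rule measure_request_measure_eq_sum[OF assms(2)]) auto
  also have "{(i, n) \<in> jobs \<tau>'. request_time \<tau>' i n \<in> ?A} =
      {(i, n) \<in> jobs \<tau>'. request_time \<tau>' i n \<in> {t\<^sub>a..<t\<^sub>b} \<and> request_time \<tau>' i n \<le> t}"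
    by auto
  finally show ?thesis
    \<comment> \<open>With lower priority the sum ranges over the empty set and the factor is 0;
      otherwise the factor is 1 and the computed sum remains.\<close>
    by (simp add: interference_request_bound_def interfering_jobs_def heaviside_upper_def)
qed

end
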